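(* Let $d\ge3$ and let $H$ be a random Hamiltonian (Hermitian operator) on $\mathbb C^d$ with eigenvalues $E_1,\dots,E_d$, where $E_1=E_{\min}$ is the minimum and $E_d=E_{\max}$ the maximum eigenvalue. Put $\Delta_{\max}=E_{\max}-E_{\min}$. Write $F(\cdot)$ for the probability density function of the indicated random variables. Assume that the prior distribution of $H$ satisfies the following. (i) The joint density of $(E_{\min},E_{\max})$ depends only on the difference $e_{\max}-e_{\min}$: $$F(E_{\min}=e_{\min},\,E_{\max}=e_{\max})=\begin{cases}F(\Delta_{\max}=e_{\max}-e_{\min}) & (e_{\max}\ge e_{\min}),\\ 0 & (\text{otherwise}).\end{cases}$$ (ii) Conditionally on $(E_{\min},E_{\max})$, the eigenvalues $E_2,\dots,E_{d-1}$ are independent, i.e. $F(E_2,\dots,E_{d-1}\mid E_{\min},E_{\max})=\prod_{k=2}^{d-1}F(E_k\mid E_{\min},E_{\max})$, and each $F(E_k\mid E_{\min},E_{\max})$ is the uniform distribution over the range from $E_{\min}$ to $E_{\max}$. For real $\tau$ put $a_{U(\tau)}=\left|\frac1d\sum_{k=1}^d e^{-iE_k\tau}\right|$. Let $t>0$, let $\epsilon$ satisfy $0<\epsilon\le 1-\left(\frac2d+\frac{d-2}{d\pi}\right)$, and put $c=\frac2d+\frac{d-2}{d\pi}+\epsilon$. For an integer $J\ge0$ let $$p_{J,\mathrm{fail}}=p\left(\Delta_{\max}\,t/2^J\ge2\pi,\ a_{U(t)}<c,\ \dots,\ a_{U(t/2^{J-1})}<c,\ a_{U(t/2^J)}\ge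 c\right),$$ that is, the probability that $\Delta_{\max}t/2^J\ge 2\pi$, $a_{U(t/2^j)}<c$ for all $0\le j\le J-1$, and $a_{U(t/2^J)}\ge c$. Then $$p_{J,\mathrm{fail}}\le 4\exp\left(-\frac{3d\epsilon^2}{6+4\epsilon}\right)\left(1+\frac{12}{d^2\epsilon^2\log(1+d\epsilon^2)}\right).$$
   Context: Here $U(\tau)=e^{-iH\tau}$ is the time evolution generated by $H$ (with $\hbar=1$), so $a_{U(\tau)}=|\mathrm{Tr}[U(\tau)]|/d$; since $H$ is random, $E_{\min}$, $E_{\max}$, $\Delta_{\max}$ and each $a_{U(\tau)}$ are random variables. $p_{J,\mathrm{fail}}$ is the failure probability, when the protocol terminates at step $J$, of the following procedure for estimating an upper bound on $\Delta_{\max}$: starting from $j=0$, evaluate $a_{U(t/2^j)}$; if it is less than $c$, increase $j$ by one and repeat; otherwise stop with $J=j$ and conclude that $\Delta_{\max}\le 2^J\cdot 2\pi/t$.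
   Formalization: Condition (i) forces a joint density of infinite total mass, so no probability distribution satisfies it; the prior is taken as an improper measure, and all probabilities, including the density of Δ_max, are conditional on E_min lying in an arbitrary set of positive finite Lebesgue measure. *)

theory Defs
  imports "HOL-Probability.Probability" "Jordan_Normal_Form.Schur_Decomposition"
begin

definition random_hermitian :: "'w measure \<Rightarrow> nat \<Rightarrow> ('w \<Rightarrow> complex mat) \<Rightarrow> bool" where
  "random_hermitian M d H \<longleftrightarrow>
     (\<forall>w\<in>space M. H w \<in> carrier_mat d d \<and> mat_adjoint (H w) = H w) \<and>
     (\<forall>i<d. \<forall>j<d. (\<lambda>w. H w $$ (i, j)) \<in> borel_measurable M)"

text \<open>The energies are listed with multiplicity, the first one being the smallest and the last
  one the largest; no order is imposed on the others.\<close>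

definition energies :: "'w measure \<Rightarrow> nat \<Rightarrow> ('w \<Rightarrow> complex mat) \<Rightarrow> (nat \<Rightarrow> 'w \<Rightarrow> real) \<Rightarrow> bool" where
  "energies M d H E \<longleftrightarrow>
     (\<forall>k\<in>{1..d}. E k \<in> borel_measurable M) \<and>
     (\<forall>w\<in>space M.
        char_poly (H w) = (\<Prod>k\<in>{1..d}. [:- complex_of_real (E k w), 1:]) \<and>
        E 1 w = Min ((\<lambda>k. E k w) ` {1..d}) \<and>
        E d w = Max ((\<lambda>k. E k w) ` {1..d}))"

definition delta_max :: "nat \<Rightarrow> (nat \<Rightarrow> 'w \<Rightarrow> real) \<Rightarrow> 'w \<Rightarrow> real" where
  "delta_max d E w = E d w - E 1 w"

text \<open>This is \<open>\<bar>Tr U(\<tau>)\<bar> / d\<close> for \<open>U(\<tau>) = exp (- i H \<tau>)\<close>.\<close>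

definition amp :: "nat \<Rightarrow> (nat \<Rightarrow> 'w \<Rightarrow> real) \<Rightarrow> real \<Rightarrow> 'w \<Rightarrow> real" where
  "amp d E \<tau> w = cmod ((1 / of_nat d) * (\<Sum>k=1..d. exp (- \<i> * complex_of_real (E k w * \<tau>))))"

text \<open>\<open>f y x\<close> is the density \<open>F(X = x | Y = y)\<close>, i.e. \<open>F(Y, X) = F(Y) F(X | Y)\<close>.\<close>

definition conditional_density ::
  "'w measure \<Rightarrow> 'x measure \<Rightarrow> 'y measure \<Rightarrow> ('w \<Rightarrow> 'x) \<Rightarrow> ('w \<Rightarrow> 'y) \<Rightarrow> ('y \<Rightarrow> 'x \<Rightarrow> ennreal) \<Rightarrow> bool" where
  "conditional_density M S T X Y f \<longleftrightarrow>
     (\<exists>h. distributed M T Y h \<and>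
          distributed M (T \<Otimes>\<^sub>M S) (\<lambda>w. (Y w, X w)) (\<lambda>(y, x). h y * f y x))"

definition uniform_density :: "real \<Rightarrow> real \<Rightarrow> real \<Rightarrow> ennreal" where
  "uniform_density a b x = ennreal (indicator {a..b} x / (b - a))"

text \<open>
  A joint density of \<open>(E\<^sub>m\<^sub>i\<^sub>n, E\<^sub>m\<^sub>a\<^sub>x)\<close> that depends on the difference only is invariant under
  a common shift of the two energies, so it has infinite total mass: the prior is improper, and a
  random Hamiltonian lives on a measure space \<open>M\<close> that is not a probability space.
  Under \<open>M\<close> the event \<open>E\<^sub>m\<^sub>i\<^sub>n \<in> B\<close> has as its measure the Lebesgue measure of \<open>B\<close>. The probability
  of an event is its probability given \<open>E\<^sub>m\<^sub>i\<^sub>n \<in> B\<close>, for a reference set \<open>B\<close> of positive finite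
  Lebesgue measure; for events on the differences of the energies (such as those on
  \<open>delta_max\<close> and \<open>amp\<close>) the choice of \<open>B\<close> is immaterial.
\<close>

definition normalized :: "'w measure \<Rightarrow> ('w \<Rightarrow> real) \<Rightarrow> real set \<Rightarrow> 'w measure" where
  "normalized M Emin B = uniform_measure M (Emin -` B \<inter> space M)"

definition p_fail ::
  "'w measure \<Rightarrow> nat \<Rightarrow> (nat \<Rightarrow> 'w \<Rightarrow> real) \<Rightarrow> real \<Rightarrow> real \<Rightarrow> nat \<Rightarrow> real" where
  "p_fail P d E t c J = measure P
     {w \<in> space P. delta_max d E w * t / 2 ^ J \<ge> 2 * pi \<and>
        (\<forall>j<J. amp d E (t / 2 ^ j) w < c) \<and> amp d E (t / 2 ^ J) w \<ge> c}"

end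

theory Submission
  imports Defs
begin

text \<open>
  Write \<open>\<tau> = t / 2^J\<close>. On the event \<open>\<Delta>\<^sub>m\<^sub>a\<^sub>x \<tau> \<ge> 2\<pi>\<close> the phases
  \<open>exp (- i E\<^sub>k \<tau>)\<close> for \<open>1 < k < d\<close> are, given the extreme energies, independent
  with a common mean of modulus at most \<open>1/\<pi>\<close>, so \<open>a \<ge> c\<close> forces the sum \<open>S\<close> of the
  \<open>n = d - 2\<close> centred phases to satisfy \<open>|S| \<ge> s = d \<epsilon>\<close>. The other requirements
  on the run of the protocol are dropped. A Bernstein inequality in the style of Pinelis gives
  \<open>P (|S| \<ge> s) \<le> 2 exp (- s\<^sup>2 / 2 / (n + 2 s / 3))\<close>, without a dimensional factor:
  for a centred \<open>X\<close>, passing from \<open>z\<close> to \<open>z + X\<close> multiplies the expectation of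
  \<open>cosh (l |z|)\<close> by at most a constant, and Markov's inequality is applied to
  \<open>cosh (l |S|)\<close>. The bound is uniform in the extreme energies, hence survives the
  integration over their improper prior.
\<close>

section \<open>Inequalities for \<open>cosh\<close>, \<open>sinh\<close> and \<open>exp\<close>,
  scalar and in inner product spaces\<close>

lemma sinh_ge_self: "x \<le> sinh (x :: real)" if "0 \<le> x"
proof -
  have "sinh 0 - 0 \<le> sinh x - x"
  proof (rule DERIV_nonneg_imp_nondecreasing[OF that])
    show "\<exists>y. ((\<lambda>x. sinh x - x) has_real_derivative y) (at u) \<and> 0 \<le> y" for u :: real
      by (rule exI[of _ "cosh u - 1"]) (auto intro!: derivative_eq_intros simp: cosh_real_ge_1)
  qed
  then show ?thesis by simp
qed

text \<open>The series of \<open>cosh\<close> has only even powers, so \<open>cosh (sqrt y)\<close>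
  is a power series in \<open>y\<close> with nonnegative coefficients, and each monomial is convex
  on the half-line. Hence \<open>cosh\<close> of a norm is a convex function of the squared
  norm.\<close>

lemma convex_on_cosh_sqrt: "convex_on {0..} (\<lambda>y. cosh (sqrt y))"
proof (rule convex_onI)
  fix t x y :: real
  assume t: "0 < t" "t < 1" and xy: "x \<in> {0..}" "y \<in> {0..}"
  define f :: "nat \<Rightarrow> real \<Rightarrow> real"
    where "f n y = (if even n then y ^ (n div 2) / fact n else 0)" for n y
  have sums: "(\<lambda>n. f n y) sums cosh (sqrt y)" if "0 \<le> y" for y
  proof -
    have "f n y = (if even n then sqrt y ^ n /\<^sub>R fact n else 0)" for n
      using that by (auto simp: f_def elim!: evenE simp: power_mult divide_inverse)
    with cosh_converges[of "sqrt y"] show ?thesis by simp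
  qed
  have pow: "convex_on {0..} (\<lambda>y::real. y ^ m)" for m
    by (cases "even m") (auto intro: convex_power_odd convex_on_subset[OF convex_power_even])
  have term_le: "f n ((1 - t) * x + t * y) \<le> (1 - t) * f n x + t * f n y" for n
  proof -
    have "((1 - t) * x + t * y) ^ (n div 2) \<le> (1 - t) * x ^ (n div 2) + t * y ^ (n div 2)"
      using convex_onD[OF pow[of "n div 2"], of t x y] t xy by simp
    then have "((1 - t) * x + t * y) ^ (n div 2) / fact n
        \<le> ((1 - t) * x ^ (n div 2) + t * y ^ (n div 2)) / fact n"
      by (intro divide_right_mono) auto
    then show ?thesis by (simp add: f_def add_divide_distrib)
  qed
  have "(\<lambda>n. (1 - t) * f n x + t * f n y) sums ((1 - t) * cosh (sqrt x) + t * cosh (sqrt y))"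
    using sums[of x] sums[of y] xy by (intro sums_add sums_mult) auto
  moreover have "(\<lambda>n. f n ((1 - t) * x + t * y)) sums cosh (sqrt ((1 - t) * x + t * y))"
    using sums t xy by auto
  ultimately show "cosh (sqrt ((1 - t) *\<^sub>R x + t *\<^sub>R y))
      \<le> (1 - t) * cosh (sqrt x) + t * cosh (sqrt y)"
    using sums_le[OF term_le] by fastforce
qed auto

text \<open>For fixed norms of \<open>x\<close> and \<open>h\<close> the left side is convex and the right side affine
  in \<open>x \<bullet> h\<close>, so only parallel vectors matter. At \<open>x = 0\<close> the junk quotient \<open>0 / 0 = 0\<close>
  is harmless.\<close>

lemma cosh_norm_add_le:
  fixes x h :: "'a :: real_inner"
  shows "cosh (norm (x + h))
    \<le> cosh (norm x) * (exp (norm h) - norm h) + sinh (norm x) / norm x * (x \<bullet> h)"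
proof (cases "x = 0 \<or> h = 0")
  case True
  then show ?thesis
    using sinh_ge_self[of "norm h"] by (auto simp: cosh_plus_sinh[symmetric])
next
  case False
  define a b where "a = norm x" and "b = norm h"
  define w where "w = (x \<bullet> h) / (a * b)"
  have ab: "a > 0" "b > 0" using False by (auto simp: a_def b_def)
  have xh: "x \<bullet> h = w * (a * b)" using ab by (simp add: w_def)
  have "\<bar>x \<bullet> h\<bar> \<le> a * b" unfolding a_def b_def by (rule Cauchy_Schwarz_ineq2)
  then have w: "\<bar>w\<bar> \<le> 1" using ab by (simp add: w_def)
  \<comment> \<open>\<open>w\<close> is the cosine of the angle between \<open>x\<close> and
    \<open>h\<close>. With weight \<open>p\<close> the squared norm of \<open>x + h\<close> is a
    convex combination of its values for antiparallel and for parallel vectors.\<close>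
  define p where "p = (1 + w) / 2"
  have p: "0 \<le> p" "p \<le> 1" using w by (auto simp: p_def)
  have "(norm (x + h))\<^sup>2 = a\<^sup>2 + b\<^sup>2 + 2 * (x \<bullet> h)"
    unfolding a_def b_def by (simp add: power2_norm_eq_inner inner_simps inner_commute)
  also have "\<dots> = (1 - p) * (a - b)\<^sup>2 + p * (a + b)\<^sup>2"
    unfolding xh p_def by (simp add: field_simps power2_eq_square)
  finally have "norm (x + h) = sqrt ((1 - p) * (a - b)\<^sup>2 + p * (a + b)\<^sup>2)"
    by (metis norm_ge_zero real_sqrt_unique)
  then have "cosh (norm (x + h)) \<le> (1 - p) * cosh (a - b) + p * cosh (a + b)"
    using convex_onD[OF convex_on_cosh_sqrt p, of "(a - b)\<^sup>2" "(a + b)\<^sup>2"] by simp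
  also have "\<dots> = cosh a * cosh b + w * sinh a * sinh b"
    unfolding p_def by (simp add: cosh_add cosh_diff field_simps)
  \<comment> \<open>Split \<open>sinh b\<close> into \<open>b\<close> and \<open>sinh b - b\<close>.
    The part linear in \<open>b\<close> is kept exactly, since it becomes the inner product and
    vanishes in the mean; only the remainder is estimated.\<close>
  also have "\<dots> \<le> cosh a * cosh b + w * sinh a * b + cosh a * (sinh b - b)"
  proof -
    have "w * sinh a \<le> 1 * sinh a" using w ab by (intro mult_right_mono) auto
    also have "\<dots> \<le> cosh a" using sinh_less_cosh_real[of a] by simp
    finally have "w * sinh a * (sinh b - b) \<le> cosh a * (sinh b - b)"
      using sinh_ge_self[of b] ab by (intro mult_right_mono) auto
    then show ?thesis by (simp add: algebra_simps)
  qed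
  also have "\<dots> = cosh a * (exp b - b) + sinh a / a * (x \<bullet> h)"
    using ab by (simp add: xh cosh_plus_sinh[symmetric] algebra_simps)
  finally show ?thesis unfolding a_def b_def .
qed

text \<open>From the quadratic term on, the exponential series is dominated by a geometric series of
  ratio \<open>x / 3\<close>, because \<open>fact (n + 2)\<close> is at least
  \<open>2 * 3 ^ n\<close>. This is the source of the 3 in Bernstein's bound.\<close>

lemma exp_le_bernstein:
  fixes x :: real
  assumes "0 \<le> x" "x < 3"
  shows "exp x \<le> 1 + x + x\<^sup>2 / 2 / (1 - x / 3)"
proof -
  have fact_ge: "2 * 3 ^ n \<le> (fact (n + 2) :: real)" for n
  proof (induction n)
    case (Suc n)
    have "2 * 3 ^ Suc n = 3 * (2 * 3 ^ n :: real)" by simp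
    also have "\<dots> \<le> (real n + 3) * fact (n + 2)" using Suc by (intro mult_mono) auto
    also have "\<dots> = fact (Suc n + 2)"
      by (simp only: add_Suc fact_Suc) (simp only: add_2_eq_Suc' of_nat_Suc of_nat_add, simp)
    finally show ?case .
  qed simp
  have term_le: "inverse (fact (n + 2)) *\<^sub>R x ^ (n + 2) \<le> x\<^sup>2 / 2 * (x / 3) ^ n" for n
  proof -
    have "inverse (fact (n + 2)) * x ^ (n + 2) \<le> inverse (2 * 3 ^ n) * x ^ (n + 2)"
      by (intro mult_right_mono le_imp_inverse_le fact_ge) (use assms in auto)
    also have "\<dots> = x\<^sup>2 / 2 * (x / 3) ^ n"
      by (simp only: power_add divide_inverse power_mult_distrib power_inverse inverse_mult_distrib ac_simps)
    finally show ?thesis unfolding real_scaleR_def .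
  qed
  have geo: "(\<lambda>n. x\<^sup>2 / 2 * (x / 3) ^ n) sums (x\<^sup>2 / 2 * (1 / (1 - x / 3)))"
    using assms by (intro sums_mult geometric_sums) auto
  have "summable (\<lambda>n. inverse (fact (n + 2)) *\<^sub>R x ^ (n + 2))"
  proof (rule summable_comparison_test')
    show "summable (\<lambda>n. x\<^sup>2 / 2 * (x / 3) ^ n)"
      using geo by (rule sums_summable)
    show "norm (inverse (fact (n + 2)) *\<^sub>R x ^ (n + 2)) \<le> x\<^sup>2 / 2 * (x / 3) ^ n" if "n \<ge> 0" for n
      using term_le[of n] assms by (simp only: real_norm_def abs_of_nonneg scaleR_nonneg_nonneg
          zero_le_power fact_ge_zero inverse_nonnegative_iff_nonnegative)
  qed
  then have "(\<Sum>n. inverse (fact (n + 2)) *\<^sub>R x ^ (n + 2)) \<le> x\<^sup>2 / 2 * (1 / (1 - x / 3))"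
    unfolding sums_unique[OF geo] by (intro suminf_le term_le sums_summable[OF geo])
  then show ?thesis unfolding exp_first_two_terms by simp
qed

section \<open>Hyperbolic moments of sums of independent centred vectors\<close>

lemma borel_measurable_cosh [measurable (raw)]:
  fixes f :: "'a \<Rightarrow> real"
  assumes "f \<in> borel_measurable M"
  shows "(\<lambda>x. cosh (f x)) \<in> borel_measurable M"
  using assms unfolding cosh_field_def by measurable

text \<open>Integrating \<open>cosh_norm_add_le\<close> kills the linear term, as the mean is 0, and
  leaves a factor \<open>1 + \<kappa> * v\<close>, which is at most
  \<open>exp (\<kappa> * v)\<close>. The factor does not depend on \<open>z\<close>, so the bound
  can be iterated.\<close>

lemma (in prob_space) nn_integral_cosh_norm_add_le:
  fixes X :: "'a \<Rightarrow> 'b :: euclidean_space"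
  assumes [measurable]: "random_variable borel X"
    and mean: "expectation X = 0"
    and bound: "\<And>w. w \<in> space M \<Longrightarrow> norm (X w) \<le> L"
    and second: "expectation (\<lambda>w. (norm (X w))\<^sup>2) \<le> v"
    and l: "0 \<le> l" "l * L < 3"
  shows "(\<integral>\<^sup>+w. ennreal (cosh (l * norm (z + X w))) \<partial>M)
    \<le> ennreal (exp (l\<^sup>2 * v / 2 / (1 - l * L / 3)) * cosh (l * norm z))"
proof -
  \<comment> \<open>\<open>\<kappa>\<close> is the quadratic coefficient after the denominator is
    bounded through \<open>L\<close>; the square of \<open>l\<close> in \<open>s\<close> comes from
    scaling both arguments of the inner product. \<open>Y\<close> is the resulting integrable
    majorant.\<close>
  define \<kappa> where "\<kappa> = l\<^sup>2 / 2 / (1 - l * L / 3)"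
  define C where "C = cosh (l * norm z)"
  define s where "s = sinh (l * norm z) / (l * norm z) * l\<^sup>2"
  define Y where "Y w = C * (1 + \<kappa> * (norm (X w))\<^sup>2) + s * (z \<bullet> X w)" for w
  have \<kappa>: "0 \<le> \<kappa>" using l unfolding \<kappa>_def by (intro divide_nonneg_nonneg) auto
  have C: "1 \<le> C" by (simp add: C_def cosh_real_ge_1)
  have le: "cosh (l * norm (z + X w)) \<le> Y w" if w: "w \<in> space M" for w
  proof -
    have n: "0 \<le> l * norm (X w)" "l * norm (X w) \<le> l * L"
      using l bound[OF w] by (auto intro: mult_left_mono)
    have "exp (l * norm (X w)) - l * norm (X w)
        \<le> 1 + (l * norm (X w))\<^sup>2 / 2 / (1 - l * norm (X w) / 3)"
      using exp_le_bernstein[of "l * norm (X w)"] n l by simp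
    also have "\<dots> \<le> 1 + (l * norm (X w))\<^sup>2 / 2 / (1 - l * L / 3)"
      using n l by (intro add_left_mono divide_left_mono mult_pos_pos) auto
    also have "\<dots> = 1 + \<kappa> * (norm (X w))\<^sup>2"
      by (simp add: \<kappa>_def power_mult_distrib)
    finally have e: "C * (exp (l * norm (X w)) - l * norm (X w)) \<le> C * (1 + \<kappa> * (norm (X w))\<^sup>2)"
      using C by (intro mult_left_mono) auto
    have "l * norm (z + X w) = norm (l *\<^sub>R z + l *\<^sub>R X w)"
      using l by (simp flip: scaleR_add_right)
    then have "cosh (l * norm (z + X w)) \<le> C * (exp (l * norm (X w)) - l * norm (X w))
        + sinh (l * norm z) / (l * norm z) * ((l *\<^sub>R z) \<bullet> (l *\<^sub>R X w))"
      using cosh_norm_add_le[of "l *\<^sub>R z" "l *\<^sub>R X w"] l by (simp add: C_def)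
    also have "sinh (l * norm z) / (l * norm z) * ((l *\<^sub>R z) \<bullet> (l *\<^sub>R X w)) = s * (z \<bullet> X w)"
      by (simp add: s_def power2_eq_square)
    finally show ?thesis using e by (simp add: Y_def)
  qed
  have int: "integrable M X"
    using bound by (intro integrable_const_bound[of _ L]) auto
  have int2: "integrable M (\<lambda>w. (norm (X w))\<^sup>2)"
    using bound by (intro integrable_const_bound[of _ "L\<^sup>2"]) (auto intro!: power_mono AE_I2)
  have intY: "integrable M Y"
    unfolding Y_def using int int2 by auto
  have "expectation Y = C * (1 + \<kappa> * expectation (\<lambda>w. (norm (X w))\<^sup>2)) + s * (z \<bullet> expectation X)"
    unfolding Y_def using int int2 by (simp add: prob_space)
  also have "\<dots> \<le> C * (1 + \<kappa> * v)"
    using second C \<kappa> mean by (simp add: mult_left_mono)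
  also have "\<dots> \<le> C * exp (\<kappa> * v)"
    using C by (intro mult_left_mono) auto
  finally have EY: "expectation Y \<le> C * exp (\<kappa> * v)" .
  have "(\<integral>\<^sup>+w. ennreal (cosh (l * norm (z + X w))) \<partial>M) \<le> (\<integral>\<^sup>+w. ennreal (Y w) \<partial>M)"
    using le by (intro nn_integral_mono) (auto intro: ennreal_leI)
  also have "\<dots> = ennreal (expectation Y)"
    using intY le by (intro nn_integral_eq_integral) (auto intro!: AE_I2 order_trans[OF cosh_real_nonneg])
  also have "\<dots> \<le> ennreal (C * exp (\<kappa> * v))"
    using EY by (rule ennreal_leI)
  finally show ?thesis
    by (simp add: C_def \<kappa>_def mult.commute)
qed

text \<open>Induction on \<open>I\<close>: the new coordinate is integrated first, with the sum over
  the other coordinates in the role of \<open>z\<close>, so each coordinate costs one factor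
  \<open>K\<close>. The densities stay as weights, the form in which the conditional law of the
  inner energies is given.\<close>

lemma (in product_sigma_finite) nn_integral_prod_cosh_norm_sum_le:
  fixes g :: "'i \<Rightarrow> 'a \<Rightarrow> 'b :: euclidean_space" and u :: "'i \<Rightarrow> 'a \<Rightarrow> ennreal"
  assumes "finite I"
    and u: "\<And>i. i \<in> I \<Longrightarrow> u i \<in> borel_measurable (M i)"
    and g: "\<And>i. i \<in> I \<Longrightarrow> g i \<in> borel_measurable (M i)"
    and step: "\<And>i z. i \<in> I \<Longrightarrow>
      (\<integral>\<^sup>+y. u i y * ennreal (cosh (l * norm (z + g i y))) \<partial>M i) \<le> ennreal (K * cosh (l * norm z))"
    and K: "0 \<le> K"
  shows "(\<integral>\<^sup>+e. (\<Prod>i\<in>I. u i (e i)) * ennreal (cosh (l * norm (\<Sum>i\<in>I. g i (e i)))) \<partial>Pi\<^sub>M I M)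
    \<le> ennreal (K ^ card I)"
  using assms(1-4)
proof (induction I)
  case empty
  then show ?case by (simp add: PiM_empty)
next
  case (insert i I)
  note [measurable] = insert.prems(1,2)
  let ?f = "\<lambda>I e. (\<Prod>i\<in>I. u i (e i)) * ennreal (cosh (l * norm (\<Sum>i\<in>I. g i (e i))))"
  have fi: "?f (insert i I) (e(i := y)) = (\<Prod>i\<in>I. u i (e i)) *
      (u i y * ennreal (cosh (l * norm ((\<Sum>i\<in>I. g i (e i)) + g i y))))" for e y
  proof -
    have "(\<Prod>j\<in>I. u j ((e(i := y)) j)) = (\<Prod>j\<in>I. u j (e j))"
      "(\<Sum>j\<in>I. g j ((e(i := y)) j)) = (\<Sum>j\<in>I. g j (e j))"
      using insert.hyps by (auto intro!: prod.cong sum.cong)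
    then show ?thesis using insert.hyps by (simp add: ac_simps)
  qed
  have meas: "?f (insert i I) \<in> borel_measurable (Pi\<^sub>M (insert i I) M)"
    by measurable
  have "integral\<^sup>N (Pi\<^sub>M (insert i I) M) (?f (insert i I))
      = (\<integral>\<^sup>+e. (\<integral>\<^sup>+y. ?f (insert i I) (e(i := y)) \<partial>M i) \<partial>Pi\<^sub>M I M)"
    by (rule product_nn_integral_insert[OF insert.hyps meas])
  also have "\<dots> = (\<integral>\<^sup>+e. (\<Prod>i\<in>I. u i (e i)) *
      (\<integral>\<^sup>+y. u i y * ennreal (cosh (l * norm ((\<Sum>i\<in>I. g i (e i)) + g i y))) \<partial>M i) \<partial>Pi\<^sub>M I M)"
    unfolding fi by (intro nn_integral_cong nn_integral_cmult) measurable
  also have "\<dots> \<le> (\<integral>\<^sup>+e. (\<Prod>i\<in>I. u i (e i)) *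
      ennreal (K * cosh (l * norm (\<Sum>i\<in>I. g i (e i)))) \<partial>Pi\<^sub>M I M)"
    using insert.prems(3) by (intro nn_integral_mono mult_left_mono) auto
  also have "\<dots> = (\<integral>\<^sup>+e. ennreal K * ?f I e \<partial>Pi\<^sub>M I M)"
    using K by (simp add: ennreal_mult ac_simps)
  also have "\<dots> = ennreal K * integral\<^sup>N (Pi\<^sub>M I M) (?f I)"
    by (rule nn_integral_cmult) measurable
  also have "\<dots> \<le> ennreal K * ennreal (K ^ card I)"
    using insert by (intro mult_left_mono) auto
  finally show ?case using insert.hyps K by (simp add: ennreal_mult)
qed


section \<open>The uniform law: its Fourier transform and the tail of a sum of phases\<close>

lemma borel_measurable_uniform_density [measurable]: "uniform_density a b \<in> borel_measurable borel"
  unfolding uniform_density_def by measurable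

lemma density_uniform_density:
  assumes "a < b"
  shows "density lborel (uniform_density a b) = uniform_measure lborel {a..b}"
  unfolding uniform_measure_def using assms
  by (intro density_cong)
     (auto simp: uniform_density_def divide_ennreal[symmetric] split: split_indicator)

lemma prob_space_uniform_density:
  assumes "a < b"
  shows "prob_space (density lborel (uniform_density a b))"
  using assms by (simp add: density_uniform_density prob_space_uniform_measure)

text \<open>The antiderivative \<open>G\<close> of the phase has modulus \<open>1 / \<tau>\<close>
  at both ends of the interval. Once \<open>(b - a) * \<tau>\<close> reaches \<open>2 * pi\<close>
  the bound is \<open>1 / pi\<close>, the constant that enters \<open>c\<close>.\<close>

lemma uniform_density_char_le:
  assumes "a < b" "0 < \<tau>"
  shows "cmod (\<integral>x. exp (- \<i> * complex_of_real (x * \<tau>)) \<partial>density lborel (uniform_density a b))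
    \<le> 2 / ((b - a) * \<tau>)"
proof -
  define f where "f x = exp (- \<i> * complex_of_real (x * \<tau>))" for x
  define G where "G x = \<i> / \<tau> * exp (- \<i> * complex_of_real (x * \<tau>))" for x
  have f_meas: "f \<in> borel_measurable borel"
    unfolding f_def by (intro borel_measurable_continuous_onI continuous_intros)
  have "integral\<^sup>L (density lborel (uniform_density a b)) f
      = (\<integral>x. (indicator {a..b} x / (b - a)) *\<^sub>R f x \<partial>lborel)"
    unfolding uniform_density_def using assms f_meas by (subst integral_density) auto
  also have "\<dots> = (\<integral>x. (1 / (b - a)) *\<^sub>R (indicator {a..b} x *\<^sub>R f x) \<partial>lborel)"
    by simp
  also have "\<dots> = (1 / (b - a)) *\<^sub>R (\<integral>x. indicator {a..b} x *\<^sub>R f x \<partial>lborel)"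
    by (rule integral_scaleR_right)
  also have "(\<integral>x. indicator {a..b} x *\<^sub>R f x \<partial>lborel) = G b - G a"
  proof (rule integral_FTC_atLeastAtMost)
    \<comment> \<open>The derivative is taken in a complex variable and then restricted to the real
      line.\<close>
    have "((\<lambda>z. \<i> / \<tau> * exp (- \<i> * (z * \<tau>))) has_field_derivative f x) (at (complex_of_real x))" for x
      unfolding f_def using assms by (auto intro!: derivative_eq_intros)
    then show "(G has_vector_derivative f x) (at x within {a..b})" for x
      using has_vector_derivative_real_field unfolding G_def by force
    show "continuous_on {a..b} f"
      unfolding f_def by (intro continuous_intros)
  qed (use assms in simp)
  finally have "cmod (integral\<^sup>L (density lborel (uniform_density a b)) f) = cmod (G b - G a) / (b - a)"
    using assms by simp
  also have "cmod (G x) = 1 / \<tau>" for x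
    using assms by (simp add: G_def norm_mult norm_divide)
  then have "cmod (G b - G a) \<le> 2 / \<tau>"
    using norm_triangle_ineq4[of "G b" "G a"] by simp
  then have "cmod (G b - G a) / (b - a) \<le> 2 / \<tau> / (b - a)"
    using assms by (intro divide_right_mono) auto
  then have "cmod (G b - G a) / (b - a) \<le> 2 / ((b - a) * \<tau>)"
    by (simp add: mult.commute)
  finally show ?thesis unfolding f_def .
qed

text \<open>Centring subtracts the squared norm of the mean from the second moment. Centred phases
  thus have second moment at most 1, although their norm is only bounded by 2.\<close>

lemma (in prob_space) expectation_norm_sub_mean_le:
  fixes X :: "'a \<Rightarrow> 'b :: euclidean_space"
  assumes [measurable]: "random_variable borel X"
    and bound: "\<And>w. w \<in> space M \<Longrightarrow> norm (X w) \<le> L"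
  shows "expectation (\<lambda>w. (norm (X w - expectation X))\<^sup>2) \<le> L\<^sup>2"
proof -
  let ?m = "expectation X"
  have int: "integrable M X"
    using bound by (intro integrable_const_bound[of _ L]) auto
  have int2: "integrable M (\<lambda>w. (norm (X w))\<^sup>2)"
    using bound by (intro integrable_const_bound[of _ "L\<^sup>2"]) (auto intro!: power_mono AE_I2)
  have "expectation (\<lambda>w. (norm (X w - ?m))\<^sup>2)
      = expectation (\<lambda>w. (norm (X w))\<^sup>2 - 2 * (?m \<bullet> X w) + (norm ?m)\<^sup>2)"
    by (intro Bochner_Integration.integral_cong)
       (auto simp: power2_norm_eq_inner inner_simps inner_commute)
  also have "\<dots> = expectation (\<lambda>w. (norm (X w))\<^sup>2) - (norm ?m)\<^sup>2"
    using int int2 by (simp add: prob_space power2_norm_eq_inner)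
  also have "\<dots> \<le> expectation (\<lambda>w. (norm (X w))\<^sup>2)" by simp
  also have "\<dots> \<le> L\<^sup>2"
    using bound int2 by (intro integral_le_const) (auto intro!: power_mono AE_I2)
  finally show ?thesis .
qed

text \<open>The means contribute at most \<open>card I / pi\<close>, so the event forces the centred
  sum to have modulus at least \<open>s\<close>; a Chernoff bound with \<open>cosh\<close> as test
  function then applies.\<close>

lemma nn_integral_uniform_phase_sum_tail:
  fixes \<tau> s :: real and I :: "'i set"
  assumes I: "finite I" "I \<noteq> {}" and \<tau>: "0 < \<tau>" "2 * pi \<le> (b - a) * \<tau>" and s: "0 \<le> s"
  shows "(\<integral>\<^sup>+e. (\<Prod>k\<in>I. uniform_density a b (e k)) *
      indicator {e. real (card I) / pi + s \<le> cmod (\<Sum>k\<in>I. exp (- \<i> * complex_of_real (e k * \<tau>)))} e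
        \<partial>Pi\<^sub>M I (\<lambda>_. lborel))
    \<le> ennreal (2 * exp (- (s\<^sup>2 / 2 / (real (card I) + 2 * s / 3))))"
proof -
  define n where "n = real (card I)"
  have n: "0 < n" using I by (simp add: n_def card_gt_0_iff)
  have "0 < (b - a) * \<tau>" using \<tau>(2) pi_gt_zero by linarith
  then have ab: "a < b" using \<tau>(1) by (simp add: zero_less_mult_iff)
  define f where "f x = exp (- \<i> * complex_of_real (x * \<tau>))" for x
  define U where "U = density lborel (uniform_density a b)"
  interpret prob_space U
    unfolding U_def by (rule prob_space_uniform_density[OF ab])
  interpret product_sigma_finite "\<lambda>_::'i. lborel :: real measure"
    by standard
  define \<mu> where "\<mu> = expectation f"
  define g where "g x = f x - \<mu>" for x
  have f_meas [measurable]: "f \<in> borel_measurable borel"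
    unfolding f_def by (intro borel_measurable_continuous_onI continuous_intros)
  have g_meas [measurable]: "g \<in> borel_measurable borel"
    unfolding g_def by measurable
  have fU: "f \<in> borel_measurable U" and gU: "g \<in> borel_measurable U"
    by (simp_all add: U_def)
  have norm_f: "cmod (f x) = 1" for x
    by (simp add: f_def)
  have "cmod \<mu> \<le> 2 / ((b - a) * \<tau>)"
    using uniform_density_char_le[OF ab \<tau>(1)] unfolding \<mu>_def U_def f_def .
  also have "\<dots> \<le> 2 / (2 * pi)"
    using \<tau>(2) pi_gt_zero by (intro divide_left_mono mult_pos_pos) (use ab \<tau> in auto)
  finally have \<mu>: "cmod \<mu> \<le> 1 / pi" by simp
  then have \<mu>1: "cmod \<mu> \<le> 1"
    using pi_gt3 by (smt (verit) divide_le_eq_1)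
  have "integrable U f"
    using norm_f fU by (intro integrable_const_bound[of _ 1]) auto
  then have mean: "expectation g = 0"
    unfolding g_def by (simp add: \<mu>_def prob_space)
  have bound: "cmod (g x) \<le> 2" for x
    unfolding g_def using norm_triangle_ineq4[of "f x" \<mu>] norm_f[of x] \<mu>1 by simp
  have second: "expectation (\<lambda>x. (cmod (g x))\<^sup>2) \<le> 1"
    using expectation_norm_sub_mean_le[OF fU, of 1] norm_f unfolding g_def \<mu>_def by simp
  \<comment> \<open>This choice gives \<open>1 - l * 2 / 3 = n / (n + 2 * s / 3)\<close>, so the
    accumulated cost of the \<open>n\<close> steps is exactly half of the gain
    \<open>l * s\<close>.\<close>
  define l where "l = s / (n + 2 * s / 3)"
  define K where "K = exp (l\<^sup>2 * 1 / 2 / (1 - l * 2 / 3))"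
  have l: "0 \<le> l" "l * 2 < 3"
    using s n by (auto simp: l_def field_simps)
  have step: "(\<integral>\<^sup>+y. uniform_density a b y * ennreal (cosh (l * cmod (z + g y))) \<partial>lborel)
      \<le> ennreal (K * cosh (l * cmod z))" for z
    using nn_integral_cosh_norm_add_le[OF gU mean bound second l, of z]
    unfolding U_def K_def by (subst (asm) nn_integral_density) auto
  have exponent: "n * (l\<^sup>2 / 2 / (1 - l * 2 / 3)) = l * s / 2"
  proof -
    have "1 - l * 2 / 3 = n / (n + 2 * s / 3)"
      using s n by (simp add: l_def field_simps)
    then have "n * (l\<^sup>2 / 2 / (1 - l * 2 / 3)) = l / 2 * (l * (n + 2 * s / 3))"
      using n by (simp add: power2_eq_square)
    also have "l * (n + 2 * s / 3) = s"
      using s n by (simp add: l_def)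
    finally show ?thesis by simp
  qed
  let ?P = "\<lambda>e. \<Prod>k\<in>I. uniform_density a b (e k)"
  let ?S = "\<lambda>e. \<Sum>k\<in>I. g (e k)"
  \<comment> \<open>Markov's inequality in pointwise form, with the density still attached; the 2
    comes from \<open>exp x \<le> 2 * cosh x\<close>.\<close>
  have "?P e * indicator {e. n / pi + s \<le> cmod (\<Sum>k\<in>I. f (e k))} e
      \<le> ennreal (2 * exp (- (l * s))) * (?P e * ennreal (cosh (l * cmod (?S e))))" for e
  proof (cases "n / pi + s \<le> cmod (\<Sum>k\<in>I. f (e k))")
    case True
    have "(\<Sum>k\<in>I. f (e k)) = ?S e + of_real n * \<mu>"
      by (simp add: g_def sum_subtractf n_def)
    then have "cmod (\<Sum>k\<in>I. f (e k)) \<le> cmod (?S e) + n * cmod \<mu>"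
      using norm_triangle_ineq[of "?S e" "of_real n * \<mu>"] n by (simp add: norm_mult)
    also have "n * cmod \<mu> \<le> n / pi"
      using mult_left_mono[OF \<mu>, of n] n by simp
    finally have "s \<le> cmod (?S e)" using True by simp
    then have "l * s \<le> l * cmod (?S e)"
      using l by (intro mult_left_mono)
    then have "exp (l * s) \<le> exp (l * cmod (?S e))"
      by simp
    also have "\<dots> \<le> 2 * cosh (l * cmod (?S e))"
      by (simp add: cosh_field_def)
    finally have "1 \<le> 2 * exp (- (l * s)) * cosh (l * cmod (?S e))"
      by (simp add: exp_minus field_simps)
    then have "1 \<le> ennreal (2 * exp (- (l * s))) * ennreal (cosh (l * cmod (?S e)))"
      by (simp flip: ennreal_mult)
    then have "?P e * 1 \<le> ?P e * (ennreal (2 * exp (- (l * s))) * ennreal (cosh (l * cmod (?S e))))"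
      by (intro mult_left_mono) auto
    then show ?thesis using True by (simp add: ac_simps)
  qed simp
  then have "(\<integral>\<^sup>+e. ?P e * indicator {e. n / pi + s \<le> cmod (\<Sum>k\<in>I. f (e k))} e \<partial>Pi\<^sub>M I (\<lambda>_. lborel))
      \<le> (\<integral>\<^sup>+e. ennreal (2 * exp (- (l * s))) * (?P e * ennreal (cosh (l * cmod (?S e)))) \<partial>Pi\<^sub>M I (\<lambda>_. lborel))"
    by (intro nn_integral_mono)
  also have "\<dots> = ennreal (2 * exp (- (l * s))) *
      (\<integral>\<^sup>+e. ?P e * ennreal (cosh (l * cmod (?S e))) \<partial>Pi\<^sub>M I (\<lambda>_. lborel))"
    by (rule nn_integral_cmult) measurable
  also have "\<dots> \<le> ennreal (2 * exp (- (l * s))) * ennreal (K ^ card I)"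
    using step I
    by (intro mult_left_mono nn_integral_prod_cosh_norm_sum_le) (auto simp: K_def)
  also have "\<dots> = ennreal (2 * exp (- (l * s)) * exp (n * (l\<^sup>2 / 2 / (1 - l * 2 / 3))))"
    by (simp add: K_def n_def exp_of_nat_mult[symmetric] ennreal_mult)
  also have "2 * exp (- (l * s)) * exp (n * (l\<^sup>2 / 2 / (1 - l * 2 / 3))) = 2 * exp (- (l * s / 2))"
    unfolding exponent by (simp flip: exp_add)
  also have "l * s / 2 = s\<^sup>2 / 2 / (n + 2 * s / 3)"
    by (simp add: l_def power2_eq_square)
  finally show ?thesis unfolding n_def f_def .
qed

section \<open>Conditioning on the reference set, and the failure event\<close>

lemma measure_uniform_measure_le:
  assumes "A \<in> sets M" "N \<in> sets M" "0 \<le> r"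
    and le: "emeasure M (N \<inter> A) \<le> ennreal r * emeasure M N"
  shows "measure (uniform_measure M N) A \<le> r"
proof -
  have "emeasure (uniform_measure M N) A = emeasure M (N \<inter> A) / emeasure M N"
    using assms by simp
  also have "\<dots> \<le> ennreal r * emeasure M N / emeasure M N"
    using le by (rule divide_right_mono_ennreal)
  also have "\<dots> \<le> ennreal r"
  \<comment> \<open>In both degenerate cases the quotient is 0, by \<open>0 * \<top> = 0\<close> and
    \<open>inverse \<top> = 0\<close> in \<open>ennreal\<close>.\<close>
  proof (cases "emeasure M N = 0 \<or> emeasure M N = \<top>")
    case True
    then show ?thesis by (auto simp: divide_ennreal_def)
  qed (simp add: ennreal_mult_divide_eq)
  finally show ?thesis
    using assms(3) by (simp add: measure_def enn2real_leI)
qed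

theorem mainTheorem4:
  fixes M :: "'w measure" and H :: "'w \<Rightarrow> complex mat" and E :: "nat \<Rightarrow> 'w \<Rightarrow> real"
    and F :: "real \<Rightarrow> ennreal" and B :: "real set"
    and d J :: nat and t \<epsilon> c :: real
  assumes "d \<ge> 3"
    and "random_hermitian M d H" and "energies M d H E"
    and "B \<in> sets lborel" and "0 < emeasure lborel B" and "emeasure lborel B < \<infinity>"
    and density_delta: "distributed (normalized M (E 1) B) lborel (delta_max d E) F"
    and joint_density: "distributed M (lborel \<Otimes>\<^sub>M lborel) (\<lambda>w. (E 1 w, E d w))
           (\<lambda>(emin, emax). if emax \<ge> emin then F (emax - emin) else 0)"
    and cond_uniform: "\<And>k. k \<in> {2..d-1} \<Longrightarrow>
           conditional_density M lborel (lborel \<Otimes>\<^sub>M lborel) (E k) (\<lambda>w. (E 1 w, E d w))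
             (\<lambda>(emin, emax). uniform_density emin emax)"
    and cond_indep: "conditional_density M (\<Pi>\<^sub>M k\<in>{2..d-1}. lborel) (lborel \<Otimes>\<^sub>M lborel)
           (\<lambda>w. \<lambda>k\<in>{2..d-1}. E k w) (\<lambda>w. (E 1 w, E d w))
             (\<lambda>(emin, emax) e. \<Prod>k\<in>{2..d-1}. uniform_density emin emax (e k))"
    and "t > 0"
    and "0 < \<epsilon>" and "\<epsilon> \<le> 1 - (2 / real d + (real d - 2) / (real d * pi))"
    and "c = 2 / real d + (real d - 2) / (real d * pi) + \<epsilon>"
  shows "p_fail (normalized M (E 1) B) d E t c J
    \<le> 4 * exp (- (3 * real d * \<epsilon>\<^sup>2 / (6 + 4 * \<epsilon>))) *
        (1 + 12 / ((real d)\<^sup>2 * \<epsilon>\<^sup>2 * ln (1 + real d * \<epsilon>\<^sup>2)))"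
proof -
  note d = \<open>d \<ge> 3\<close> and \<epsilon> = \<open>0 < \<epsilon>\<close>
  define I where "I = {2..d-1}"
  define S where "S = (\<Pi>\<^sub>M k\<in>I. lborel :: real measure)"
  define T where "T = (lborel :: real measure) \<Otimes>\<^sub>M (lborel :: real measure)"
  define X where "X w = (\<lambda>k\<in>I. E k w)" for w
  define Y where "Y w = (E 1 w, E d w)" for w
  define \<tau> where "\<tau> = t / 2 ^ J"
  \<comment> \<open>\<open>s\<close> is what remains of \<open>d * c\<close> after subtracting 2 for
    the two extreme phases and \<open>n / pi\<close> for the means of the others.\<close>
  define s where "s = real d * \<epsilon>"
  define n where "n = real (card I)"
  have I: "finite I" "I \<noteq> {}" and n: "n = real d - 2"
    using d by (auto simp: I_def n_def)
  have \<tau>: "0 < \<tau>" using \<open>t > 0\<close> by (simp add: \<tau>_def)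
  have s: "0 < s" using d \<epsilon> by (simp add: s_def)
  have E_meas [measurable]: "E k \<in> borel_measurable M" if "k \<in> {1..d}" for k
    using \<open>energies M d H E\<close> that by (auto simp: energies_def)
  have E1 [measurable]: "E 1 \<in> borel_measurable M" and Ed [measurable]: "E d \<in> borel_measurable M"
    using d by (auto intro!: E_meas)
  have B [measurable]: "B \<in> sets borel" using \<open>B \<in> sets lborel\<close> by simp

  define f where "f = (\<lambda>(a, b) e. \<Prod>k\<in>I. uniform_density a b (e k))"
  obtain h where hY: "distributed M T Y h"
    and hYX: "distributed M (T \<Otimes>\<^sub>M S) (\<lambda>w. (Y w, X w)) (\<lambda>(y, x). h y * f y x)"
    using cond_indep unfolding conditional_density_def X_def Y_def S_def T_def I_def f_def by blast
  have h_meas [measurable]: "h \<in> borel_measurable T"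
    using hY by (rule distributed_borel_measurable)
  have X_meas [measurable]: "X \<in> measurable M S" and Y_meas [measurable]: "Y \<in> measurable M T"
    using distributed_measurable[OF hYX] distributed_measurable[OF hY]
    by (auto dest: measurable_compose[OF _ measurable_snd])
  interpret product_sigma_finite "\<lambda>_::nat. lborel :: real measure"
    by standard
  interpret S: sigma_finite_measure S
    unfolding S_def using I(1) by (rule sigma_finite)

  \<comment> \<open>\<open>G1\<close> constrains only the extreme energies and \<open>G2\<close>
    only the inner ones. The failure event within \<open>N\<close> lies in the preimage of the
    rectangle \<open>G1 \<times> G2\<close>, on which the integrals separate.\<close>
  define G1 where "G1 = {y \<in> space T. fst y \<in> B \<and> 2 * pi \<le> (snd y - fst y) * \<tau>}"
  define G2 where "G2 = {e \<in> space S. n / pi + s \<le> cmod (\<Sum>k\<in>I. exp (- \<i> * complex_of_real (e k * \<tau>)))}"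
  define r where "r = 2 * exp (- (s\<^sup>2 / 2 / (n + 2 * s / 3)))"
  define N where "N = E 1 -` B \<inter> space M"
  define A where "A = {w \<in> space M. delta_max d E w * t / 2 ^ J \<ge> 2 * pi \<and>
        (\<forall>j<J. amp d E (t / 2 ^ j) w < c) \<and> amp d E (t / 2 ^ J) w \<ge> c}"
  have r: "0 \<le> r" by (simp add: r_def)
  have G1 [measurable]: "G1 \<in> sets T"
    unfolding G1_def T_def by measurable
  have phase_meas: "(\<lambda>x. exp (- \<i> * complex_of_real (x * u))) \<in> borel_measurable borel" for u :: real
    by (intro borel_measurable_continuous_onI continuous_intros)
  note [measurable] = phase_meas[THEN measurable_compose[rotated]]
  have G2 [measurable]: "G2 \<in> sets S"
    unfolding G2_def S_def by measurable
  have N [measurable]: "N \<in> sets M"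
    unfolding N_def by measurable
  have amp_meas [measurable]: "amp d E u \<in> borel_measurable M" for u
    unfolding amp_def by measurable
  have A [measurable]: "A \<in> sets M"
    unfolding A_def delta_max_def by measurable

  have tail: "(\<integral>\<^sup>+x. f y x * indicator G2 x \<partial>S) \<le> ennreal r" if "y \<in> G1" for y
  proof -
    have "(\<integral>\<^sup>+x. f y x * indicator G2 x \<partial>S) = (\<integral>\<^sup>+e. (\<Prod>k\<in>I. uniform_density (fst y) (snd y) (e k)) *
      indicator {e. n / pi + s \<le> cmod (\<Sum>k\<in>I. exp (- \<i> * complex_of_real (e k * \<tau>)))} e \<partial>S)"
      by (intro nn_integral_cong) (auto simp: f_def G2_def case_prod_beta split: split_indicator)
    also have "\<dots> \<le> ennreal r"
      unfolding S_def n_def r_def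
      by (rule nn_integral_uniform_phase_sum_tail) (use I \<tau> s that in \<open>auto simp: G1_def\<close>)
    finally show ?thesis .
  qed
  have sub: "N \<inter> A \<subseteq> (\<lambda>w. (Y w, X w)) -` (G1 \<times> G2) \<inter> space M"
  proof
    fix w assume w: "w \<in> N \<inter> A"
    then have wM: "w \<in> space M" by (simp add: A_def)
    let ?e = "\<lambda>k. exp (- \<i> * complex_of_real (E k w * \<tau>))"
    have split: "{1..d} = insert 1 (insert d I)" and notin: "1 \<notin> insert d I" "d \<notin> I"
      using d by (auto simp: I_def)
    have "real d * c \<le> real d * amp d E \<tau> w"
      using w by (intro mult_left_mono) (auto simp: A_def \<tau>_def)
    also have "\<dots> = cmod (\<Sum>k=1..d. ?e k)"
      using d by (simp add: amp_def norm_mult norm_divide)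
    also have "(\<Sum>k=1..d. ?e k) = ?e 1 + (?e d + (\<Sum>k\<in>I. ?e k))"
      unfolding split using I(1) notin by simp
    also have "cmod \<dots> \<le> 2 + cmod (\<Sum>k\<in>I. ?e k)"
      using norm_triangle_ineq[of "?e 1" "?e d + (\<Sum>k\<in>I. ?e k)"]
        norm_triangle_ineq[of "?e d" "\<Sum>k\<in>I. ?e k"] by simp
    finally have "real d * c - 2 \<le> cmod (\<Sum>k\<in>I. ?e k)" by simp
    moreover have "real d * c - 2 = n / pi + s"
      using d \<open>c = _\<close> by (simp add: n s_def field_simps)
    ultimately have "X w \<in> G2"
      using measurable_space[OF X_meas wM] by (simp add: G2_def X_def)
    moreover have "Y w \<in> G1"
      using w measurable_space[OF Y_meas wM]
      by (simp add: G1_def Y_def N_def A_def delta_max_def \<tau>_def)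
    ultimately show "w \<in> (\<lambda>w. (Y w, X w)) -` (G1 \<times> G2) \<inter> space M"
      using wM by simp
  qed
  have "emeasure M (N \<inter> A) \<le> emeasure M ((\<lambda>w. (Y w, X w)) -` (G1 \<times> G2) \<inter> space M)"
    using sub by (intro emeasure_mono) measurable
  also have "\<dots> = (\<integral>\<^sup>+p. (case p of (y, x) \<Rightarrow> h y * f y x) * indicator (G1 \<times> G2) p \<partial>(T \<Otimes>\<^sub>M S))"
    by (rule distributed_emeasure[OF hYX]) measurable
  also have "\<dots> = (\<integral>\<^sup>+y. (\<integral>\<^sup>+x. h y * f y x * indicator (G1 \<times> G2) (y, x) \<partial>S) \<partial>T)"
    using distributed_borel_measurable[OF hYX]
    by (subst S.nn_integral_fst[symmetric]) auto
  also have "\<dots> = (\<integral>\<^sup>+y. (\<integral>\<^sup>+x. (h y * indicator G1 y) * (f y x * indicator G2 x) \<partial>S) \<partial>T)"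
    by (intro nn_integral_cong) (auto split: split_indicator)
  also have "\<dots> = (\<integral>\<^sup>+y. (h y * indicator G1 y) * (\<integral>\<^sup>+x. f y x * indicator G2 x \<partial>S) \<partial>T)"
  proof (intro nn_integral_cong nn_integral_cmult)
    have "f y \<in> borel_measurable S" for y
      unfolding f_def S_def case_prod_beta by measurable
    then show "(\<lambda>x. f y x * indicator G2 x) \<in> borel_measurable S" for y
      by measurable
  qed
  also have "\<dots> \<le> (\<integral>\<^sup>+y. ennreal r * (h y * indicator G1 y) \<partial>T)"
  proof (rule nn_integral_mono)
    show "(h y * indicator G1 y) * (\<integral>\<^sup>+x. f y x * indicator G2 x \<partial>S)
        \<le> ennreal r * (h y * indicator G1 y)" for y
      using mult_left_mono[OF tail[of y], of "h y"] by (cases "y \<in> G1") (auto simp: mult.commute)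
  qed
  also have "\<dots> = ennreal r * (\<integral>\<^sup>+y. h y * indicator G1 y \<partial>T)"
    by (intro nn_integral_cmult) measurable
  \<comment> \<open>The outer integral is turned back into the measure of an event inside
    \<open>N\<close>, so the prior enters only through \<open>emeasure M N\<close>, which the
    normalization divides out.\<close>
  also have "(\<integral>\<^sup>+y. h y * indicator G1 y \<partial>T) = emeasure M (Y -` G1 \<inter> space M)"
    by (rule distributed_emeasure[OF hY, symmetric]) measurable
  also have "\<dots> \<le> emeasure M N"
    by (rule emeasure_mono[OF _ N]) (auto simp: N_def G1_def Y_def)
  finally have "emeasure M (N \<inter> A) \<le> ennreal r * emeasure M N"
    by (simp add: mult_left_mono)
  then have "measure (uniform_measure M N) A \<le> r"
    using A N r by (intro measure_uniform_measure_le)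
  then have "p_fail (normalized M (E 1) B) d E t c J \<le> r"
    unfolding p_fail_def normalized_def A_def N_def by simp
  \<comment> \<open>Replacing \<open>n = d - 2\<close> by \<open>d\<close> enlarges the denominator;
    then \<open>s = d * \<epsilon>\<close> lets a factor \<open>d\<close> cancel and yields the
    stated exponent.\<close>
  also have "r \<le> 2 * exp (- (s\<^sup>2 / 2 / (real d + 2 * s / 3)))"
    unfolding r_def n using d s
    by (intro mult_left_mono iffD2[OF exp_le_cancel_iff] le_imp_neg_le divide_left_mono mult_pos_pos) auto
  also have "s\<^sup>2 / 2 / (real d + 2 * s / 3) = 3 * real d * \<epsilon>\<^sup>2 / (6 + 4 * \<epsilon>)"
  proof -
    have q: "real d + 2 * s / 3 = real d * ((6 + 4 * \<epsilon>) / 6)" by (simp add: s_def algebra_simps)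
    show ?thesis unfolding q using d by (simp add: s_def power2_eq_square)
  qed
  also have "2 * exp (- (3 * real d * \<epsilon>\<^sup>2 / (6 + 4 * \<epsilon>)))
      \<le> (4 * exp (- (3 * real d * \<epsilon>\<^sup>2 / (6 + 4 * \<epsilon>)))) * 1"
    by simp
  \<comment> \<open>The logarithm is nonnegative, so the last factor is at least 1.\<close>
  also have "\<dots> \<le> (4 * exp (- (3 * real d * \<epsilon>\<^sup>2 / (6 + 4 * \<epsilon>)))) *
      (1 + 12 / ((real d)\<^sup>2 * \<epsilon>\<^sup>2 * ln (1 + real d * \<epsilon>\<^sup>2)))"
    by (intro mult_left_mono) auto
  finally show ?thesis .
qed

end
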